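(* Let $\{X_i: i\in \mathbb{N}\}$ be a collection of real Banach spaces, let $Y_i$ be a closed linear subspace of $X_i$ for every $i\in \mathbb{N}$, and let $1\leq p < \infty$. Let $X=(\oplus_pX_i)_{i \in \mathbb{N}}$, $Y=(\oplus_pY_i)_{i \in \mathbb{N}}$ and $F=\prod_{i \in \mathbb{N}}F_i \in \mathcal{P}(X)$. Then $(Y_i, F_i)$ has property-$(P_1)$ for every $i\in \mathbb{N}$ if and only if $(Y, F)$ has property-$(P_1)$.
   Context: For a real Banach space $X$, $CL(X)$ and $CB(X)$ denote the sets of non-empty closed, respectively non-empty closed bounded, subsets of $X$; $B_X$ is the closed unit ball. For $x\in X$ and $F\in CB(X)$, $r(x,F)=\sup\{\|x-a\|: a\in F\}$. For $V\in CL(X)$, $rad_V(F)=\inf\{r(v,F): v\in V\}$, $Z_V(F)=\{v\in V: r(v,F)=rad_V(F)\}$, and for $\delta\ge 0$, $Z_V(F,\delta)=\{v\in V: r(v,F)\le rad_V(F)+\delta\}$. The pair $(V,F)$ has property-$(P_1)$ if $Z_V(F)\neq\emptyset$ and for every $\epsilon>0$ there exists $\delta>0$ such that $Z_V(F,\delta)\subseteq Z_V(F)+\epsilon B_X$. $(\oplus_p X_i)_{i\in\mathbb{N}}$ is the $\ell_p$-direct sum: all $x=(x_i)_{i\in\mathbb{N}}$ with $x_i\in X_i$ and $\|x\|=(\sum_{i}\|x_i\|^p)^{1/p}<\infty$; $Y=(\oplus_p Y_i)_{i\in\mathbb{N}}$ is regarded as a closed subspace of $X$. $\mathcal{P}(X)$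 denotes the collection of all $F\in CB(X)$ of the form $F=\prod_{i\in\mathbb{N}}F_i$ (full Cartesian product, contained in $X$) with $F_i\in CB(X_i)$ for every $i$. *)

theory Defs
  imports "HOL-Analysis.Analysis" "HOL-Algebra.Module" "HOL-Algebra.AbelCoset"
begin

section \<open>Real Banach spaces on explicit carriers\<close>

text \<open>
  The spaces of the family \<open>X\<^sub>0, X\<^sub>1, \<dots>\<close> may differ, so a normed space is a structure with its own
  carrier, operations and norm: a module over the field of reals in the sense of
  \<^theory>\<open>HOL-Algebra.Module\<close>, extended by a norm. The type \<open>'a\<close> only supplies names
  for the vectors. The module record inherits the fields \<open>mult\<close> and \<open>one\<close> from the ring record;
  they play no role.
\<close>

definition real_ring :: "real ring" where
  "real_ring = \<lparr>carrier = UNIV, mult = (*), one = 1, zero = 0, add = (+)\<rparr>"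

lemma cring_real_ring: "cring real_ring"
proof (rule cringI)
  show "abelian_group real_ring"
    by (rule abelian_groupI)
      (auto simp: real_ring_def algebra_simps intro: exI[of _ "- x" for x :: real])
  show "comm_monoid real_ring"
    by (rule comm_monoidI) (auto simp: real_ring_def)
qed (auto simp: real_ring_def algebra_simps)

record 'a normed_space = "(real, 'a) module" +
  vnorm :: "'a \<Rightarrow> real"

locale real_normed_space = Module.module real_ring X
  for X :: "'a normed_space" (structure) +
  assumes vnorm_eq_0_iff: "x \<in> carrier X \<Longrightarrow> vnorm X x = 0 \<longleftrightarrow> x = \<zero>"
    and vnorm_smult: "x \<in> carrier X \<Longrightarrow> vnorm X (c \<odot> x) = \<bar>c\<bar> * vnorm X x"
    and vnorm_triangle:
      "\<lbrakk>x \<in> carrier X; y \<in> carrier X\<rbrakk> \<Longrightarrow> vnorm X (x \<oplus> y) \<le> vnorm X x + vnorm X y"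

text \<open>
  The value \<open>0\<close> off the carrier is there because \<^locale>\<open>Metric_space\<close> requires symmetry and
  nonnegativity of the distance function on the whole type.
\<close>

definition vdist :: "'a normed_space \<Rightarrow> 'a \<Rightarrow> 'a \<Rightarrow> real" where
  "vdist X x y =
     (if x \<in> carrier X \<and> y \<in> carrier X then vnorm X (x \<ominus>\<^bsub>X\<^esub> y) else 0)"

context real_normed_space
begin

lemma vnorm_minus: "x \<in> carrier X \<Longrightarrow> vnorm X (\<ominus> x) = vnorm X x"
proof -
  assume x: "x \<in> carrier X"
  have "\<ominus>\<^bsub>real_ring\<^esub> \<one>\<^bsub>real_ring\<^esub> = -1"
    by (rule R.minus_equality) (auto simp: real_ring_def)
  then have "\<ominus> x = (-1) \<odot> x"
    using smult_l_minus[of "\<one>\<^bsub>real_ring\<^esub>" x] smult_one[OF x] x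
    by (simp add: real_ring_def)
  then show ?thesis
    using vnorm_smult[OF x, of "-1"] by simp
qed

lemma vnorm_nonneg: "x \<in> carrier X \<Longrightarrow> 0 \<le> vnorm X x"
  using vnorm_triangle[of x "\<ominus> x"] vnorm_minus[of x] vnorm_eq_0_iff[of "\<zero>"]
  by (simp add: M.r_neg)

lemma Metric_space_vdist: "Metric_space (carrier X) (vdist X)"
proof
  fix x y z
  show "0 \<le> vdist X x y"
    by (auto simp: vdist_def vnorm_nonneg)
  show "vdist X x y = vdist X y x"
  proof (cases "x \<in> carrier X \<and> y \<in> carrier X")
    case True
    then have "\<ominus> (x \<ominus> y) = y \<ominus> x"
      by (simp add: a_minus_def M.minus_add M.a_comm)
    then show ?thesis
      using vnorm_minus[of "x \<ominus> y"] True by (simp add: vdist_def)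
  qed (auto simp: vdist_def)
  show "vdist X x y = 0 \<longleftrightarrow> x = y" if "x \<in> carrier X" "y \<in> carrier X"
    using that M.minus_equality[of x "\<ominus> y"]
    by (auto simp: vdist_def vnorm_eq_0_iff a_minus_def M.r_neg)
  show "vdist X x z \<le> vdist X x y + vdist X y z"
    if "x \<in> carrier X" "y \<in> carrier X" "z \<in> carrier X"
  proof -
    have "x \<ominus> z = (x \<ominus> y) \<oplus> (y \<ominus> z)"
      using that by (simp add: a_minus_def M.a_assoc M.r_neg2 M.r_neg1)
    then show ?thesis
      using that vnorm_triangle[of "x \<ominus> y" "y \<ominus> z"] by (simp add: vdist_def)
  qed
qed

end

locale real_banach_space = real_normed_space +
  assumes complete: "Metric_space.mcomplete (carrier X) (vdist X)"

abbreviation vtopology :: "'a normed_space \<Rightarrow> 'a topology" where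
  "vtopology X \<equiv> Metric_space.mtopology (carrier X) (vdist X)"

definition closed_linear_subspace :: "'a set \<Rightarrow> 'a normed_space \<Rightarrow> bool" where
  "closed_linear_subspace Y X \<longleftrightarrow> submodule Y real_ring X \<and> closedin (vtopology X) Y"

definition unit_ball :: "'a normed_space \<Rightarrow> 'a set" where
  "unit_ball X = {x \<in> carrier X. vnorm X x \<le> 1}"

definition CB :: "'a normed_space \<Rightarrow> 'a set set" where
  "CB X = {F. F \<noteq> {} \<and> closedin (vtopology X) F \<and>
              Metric_space.mbounded (carrier X) (vdist X) F}"


section \<open>Restricted Chebyshev centers\<close>

definition radius :: "'a normed_space \<Rightarrow> 'a \<Rightarrow> 'a set \<Rightarrow> real" where
  "radius X x F = (SUP a\<in>F. vnorm X (x \<ominus>\<^bsub>X\<^esub> a))"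

definition cheb_rad :: "'a normed_space \<Rightarrow> 'a set \<Rightarrow> 'a set \<Rightarrow> real" where
  "cheb_rad X V F = (INF v\<in>V. radius X v F)"

definition cheb_centers :: "'a normed_space \<Rightarrow> 'a set \<Rightarrow> 'a set \<Rightarrow> 'a set" where
  "cheb_centers X V F = {v \<in> V. radius X v F = cheb_rad X V F}"

definition near_centers :: "'a normed_space \<Rightarrow> 'a set \<Rightarrow> 'a set \<Rightarrow> real \<Rightarrow> 'a set" where
  "near_centers X V F \<delta> = {v \<in> V. radius X v F \<le> cheb_rad X V F + \<delta>}"

definition property_P1 :: "'a normed_space \<Rightarrow> 'a set \<Rightarrow> 'a set \<Rightarrow> bool" where
  "property_P1 X V F \<longleftrightarrow>
     cheb_centers X V F \<noteq> {} \<and>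
     (\<forall>\<epsilon>>0. \<exists>\<delta>>0. near_centers X V F \<delta> \<subseteq>
        cheb_centers X V F <+>\<^bsub>X\<^esub> (\<lambda>b. \<epsilon> \<odot>\<^bsub>X\<^esub> b) ` unit_ball X)"


section \<open>The \<open>\<ell>\<^sub>p\<close>-direct sum\<close>

definition lp_sum :: "real \<Rightarrow> (nat \<Rightarrow> 'a normed_space) \<Rightarrow> (nat \<Rightarrow> 'a) normed_space" where
  "lp_sum p X =
     \<lparr>carrier = {x. (\<forall>i. x i \<in> carrier (X i)) \<and> summable (\<lambda>i. vnorm (X i) (x i) powr p)},
      mult = undefined, one = undefined,
      zero = (\<lambda>i. \<zero>\<^bsub>X i\<^esub>),
      add = (\<lambda>x y i. x i \<oplus>\<^bsub>X i\<^esub> y i),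
      smult = (\<lambda>c x i. c \<odot>\<^bsub>X i\<^esub> x i),
      vnorm = (\<lambda>x. (\<Sum>i. vnorm (X i) (x i) powr p) powr (1 / p))\<rparr>"

text \<open>The direct sum of subsets \<open>Y\<^sub>i\<close> of \<open>X\<^sub>i\<close>, each with the norm of \<open>X\<^sub>i\<close>, as a subset of the
  direct sum of the \<open>X\<^sub>i\<close>.\<close>

definition lp_sum_sub :: "real \<Rightarrow> (nat \<Rightarrow> 'a normed_space) \<Rightarrow> (nat \<Rightarrow> 'a set) \<Rightarrow> (nat \<Rightarrow> 'a) set" where
  "lp_sum_sub p X Y = carrier (lp_sum p (\<lambda>i. (X i)\<lparr>carrier := Y i\<rparr>))"

definition product_CB :: "real \<Rightarrow> (nat \<Rightarrow> 'a normed_space) \<Rightarrow> (nat \<Rightarrow> 'a) set set" where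
  "product_CB p X =
     {F \<in> CB (lp_sum p X). \<exists>F'. (\<forall>i. F' i \<in> CB (X i)) \<and> F = Pi UNIV F'}"

end

theory Submission
  imports Defs
begin

text \<open>
  Over a product of sets the suprema decouple, so
  \<open>r(x, \<Prod> F\<^sub>i)\<^sup>p = \<Sum> r(x\<^sub>i, F\<^sub>i)\<^sup>p\<close>, and consequently \<open>rad\<^sup>p\<close> is the sum of the \<open>rad\<^sub>i\<^sup>p\<close> and the
  centers of the product are exactly the sequences of centers. A \<open>\<delta>\<close>-near center \<open>y\<close> has total
  excess \<open>\<Sum> (r(y\<^sub>i, F\<^sub>i)\<^sup>p - rad\<^sub>i\<^sup>p)\<close> below a small \<open>\<eta>\<close>. Finitely many coordinates are then
  handled by the property of \<open>(Y\<^sub>i, F\<^sub>i)\<close>, while in the tail \<open>\<parallel>y\<^sub>i - z\<^sub>i\<parallel> \<le> 2 r(y\<^sub>i, F\<^sub>i)\<close> for any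
  center \<open>z\<^sub>i\<close>, and the \<open>p\<close>-th powers of these bounds sum to at most \<open>2\<^sup>p\<close> times the tail of
  \<open>\<Sum> rad\<^sub>i\<^sup>p\<close> plus \<open>2\<^sup>p \<eta>\<close>. Conversely, a near center of one coordinate is completed by
  centers in all the others.
\<close>

section \<open>Powers with a real exponent\<close>

text \<open>A sum is at most twice its larger term. The constant is crude but suffices for
  summability, and \<open>p\<close> may be below 1.\<close>

lemma powr_add_le:
  fixes a b p :: real
  assumes "0 \<le> a" "0 \<le> b" "0 \<le> p"
  shows "(a + b) powr p \<le> 2 powr p * (a powr p + b powr p)"
proof -
  have "(a + b) powr p \<le> (2 * max a b) powr p"
    using assms by (intro powr_mono2) auto
  also have "\<dots> = 2 powr p * max a b powr p"
    using assms by (simp add: powr_mult)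
  also have "\<dots> \<le> 2 powr p * (a powr p + b powr p)"
    by (intro mult_left_mono) (auto simp: max_def)
  finally show ?thesis .
qed

text \<open>Convexity of the power function at \<open>a / A\<close> and \<open>b / B\<close>, with
  weights \<open>A / (A + B)\<close> and \<open>B / (A + B)\<close>. With \<open>A\<close> and
  \<open>B\<close> the norms of two sequences, summing over the coordinates yields Minkowski's
  inequality.\<close>

lemma powr_add_le_convex:
  fixes a b A B p :: real
  assumes "0 \<le> a" "0 \<le> b" "0 < A" "0 < B" "1 \<le> p"
  shows "(a + b) powr p \<le>
    (A + B) powr p * (A / (A + B) * (a powr p / A powr p) + B / (A + B) * (b powr p / B powr p))"
proof -
  \<comment> \<open>Serves the case where \<open>x\<close> or \<open>y\<close> is zero:
    \<open>t powr p\<close> is at most \<open>t\<close> on the unit interval. For positive arguments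
    convexity applies directly.\<close>
  have scale: "(t * x) powr p \<le> t * x powr p" if "0 \<le> t" "t \<le> 1" "0 \<le> x" for t x :: real
  proof -
    have "t powr p \<le> t powr 1"
      using that assms by (intro powr_mono') auto
    then show ?thesis
      using that by (simp add: powr_mult mult_right_mono)
  qed
  define u where "u = B / (A + B)"
  define x where "x = a / A"
  define y where "y = b / B"
  have u: "0 \<le> u" "u \<le> 1" and xy: "0 \<le> x" "0 \<le> y" and u': "A / (A + B) = 1 - u"
    using assms by (auto simp: u_def x_def y_def field_simps)
  have "((1 - u) * x + u * y) powr p \<le> (1 - u) * x powr p + u * y powr p"
  proof (cases "x = 0 \<or> y = 0")
    case True
    then show ?thesis using scale[of u y] scale[of "1 - u" x] u xy by auto
  next
    case False
    then show ?thesis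
      using convex_onD[OF powr_convex[OF assms(5)] u, of x y] xy by simp
  qed
  then have "(A + B) powr p * ((1 - u) * x + u * y) powr p
      \<le> (A + B) powr p * ((1 - u) * x powr p + u * y powr p)"
    by (intro mult_left_mono) auto
  moreover have "a + b = (A + B) * ((1 - u) * x + u * y)"
  proof -
    have "(A + B) * (1 - u) = A" "(A + B) * u = B"
      unfolding u'[symmetric] using assms by (simp_all add: u_def)
    then show ?thesis
      using assms unfolding distrib_left mult.assoc[symmetric] by (simp add: x_def y_def)
  qed
  moreover have "0 \<le> (1 - u) * x + u * y" using u xy by simp
  ultimately show ?thesis
    using assms by (simp add: u' powr_mult powr_divide x_def y_def flip: u_def)
qed

text \<open>Converts an allowance \<eta> for p-th powers into an allowance \<delta> for the radii
  themselves. The witness makes the inequality an equality.\<close>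

lemma powr_add_le_ex:
  fixes c p \<eta> :: real
  assumes "0 \<le> c" "0 < p" "0 < \<eta>"
  obtains \<delta> where "0 < \<delta>" "(c + \<delta>) powr p \<le> c powr p + \<eta>"
proof
  have "c = (c powr p) powr (1 / p)"
    using assms by (simp add: powr_powr)
  also have "\<dots> < (c powr p + \<eta>) powr (1 / p)"
    using assms by (intro powr_less_mono2) auto
  finally show "0 < (c powr p + \<eta>) powr (1 / p) - c" by simp
  show "(c + ((c powr p + \<eta>) powr (1 / p) - c)) powr p \<le> c powr p + \<eta>"
    using assms by (simp add: powr_powr)
qed

lemma powr_le_iff_le_powr_inverse:
  fixes a b p :: real
  assumes "0 \<le> a" "0 \<le> b" "0 < p"
  shows "a powr (1 / p) \<le> b \<longleftrightarrow> a \<le> b powr p"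
proof
  assume "a powr (1 / p) \<le> b"
  then have "(a powr (1 / p)) powr p \<le> b powr p"
    using assms by (intro powr_mono2) auto
  then show "a \<le> b powr p" using assms by (simp add: powr_powr)
next
  assume "a \<le> b powr p"
  then have "a powr (1 / p) \<le> (b powr p) powr (1 / p)"
    using assms by (intro powr_mono2) auto
  then show "a powr (1 / p) \<le> b" using assms by (simp add: powr_powr)
qed

lemma powr_le_powr_iff:
  fixes a b p :: real
  assumes "0 \<le> a" "0 \<le> b" "0 < p"
  shows "a powr p \<le> b powr p \<longleftrightarrow> a \<le> b"
  using powr_less_mono2[of p b a] powr_mono2[of p a b] assms by (auto simp: not_less[symmetric])

section \<open>Series of p-th powers and Minkowski's inequality\<close>

lemma summable_powr_add:
  fixes a b :: "nat \<Rightarrow> real"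
  assumes "\<And>i. 0 \<le> a i" "\<And>i. 0 \<le> b i" "0 \<le> p"
    and "summable (\<lambda>i. a i powr p)" "summable (\<lambda>i. b i powr p)"
  shows "summable (\<lambda>i. (a i + b i) powr p)"
proof (rule summable_comparison_test')
  show "summable (\<lambda>i. 2 powr p * (a i powr p + b i powr p))"
    by (intro summable_mult summable_add assms)
  show "norm ((a i + b i) powr p) \<le> 2 powr p * (a i powr p + b i powr p)" for i
    using powr_add_le[of "a i" "b i" p] assms by simp
qed

text \<open>Both sequences are normalised by their norms \<open>A\<close> and \<open>B\<close>, and
  the convexity bound is summed. If a norm is zero, normalisation is impossible, but then that
  sequence vanishes.\<close>

lemma Minkowski_suminf:
  fixes a b :: "nat \<Rightarrow> real"
  assumes "\<And>i. 0 \<le> a i" "\<And>i. 0 \<le> b i" "1 \<le> p"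
    and sa: "summable (\<lambda>i. a i powr p)" and sb: "summable (\<lambda>i. b i powr p)"
  shows "(\<Sum>i. (a i + b i) powr p) powr (1 / p) \<le>
    (\<Sum>i. a i powr p) powr (1 / p) + (\<Sum>i. b i powr p) powr (1 / p)"
proof -
  define A where "A = (\<Sum>i. a i powr p) powr (1 / p)"
  define B where "B = (\<Sum>i. b i powr p) powr (1 / p)"
  have Ap: "A powr p = (\<Sum>i. a i powr p)" and Bp: "B powr p = (\<Sum>i. b i powr p)"
    using assms by (auto simp: A_def B_def powr_powr suminf_nonneg)
  have z: "f i = 0" if "summable (\<lambda>i. f i powr p)" "(\<Sum>i. f i powr p) = 0" for f :: "nat \<Rightarrow> real" and i
    using suminf_eq_zero_iff[of "\<lambda>i. f i powr p"] that by simp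
  consider "A = 0" | "B = 0" | "0 < A" "0 < B"
    unfolding A_def B_def by (metis less_eq_real_def powr_ge_zero)
  then have "(\<Sum>i. (a i + b i) powr p) powr (1 / p) \<le> A + B"
  proof cases
    case 1
    then have "a i = 0" for i using z[OF sa] Ap by simp
    then show ?thesis using 1 by (simp add: B_def)
  next
    case 2
    then have "b i = 0" for i using z[OF sb] Bp by simp
    then show ?thesis using 2 by (simp add: A_def)
  next
    case 3
    have sA: "(\<lambda>i. A / (A + B) * (a i powr p / A powr p)) sums (A / (A + B) * (A powr p / A powr p))"
      unfolding Ap using sa by (intro sums_mult sums_divide summable_sums)
    have sB: "(\<lambda>i. B / (A + B) * (b i powr p / B powr p)) sums (B / (A + B) * (B powr p / B powr p))"
      unfolding Bp using sb by (intro sums_mult sums_divide summable_sums)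
    \<comment> \<open>After normalisation both series sum to 1, so only the two weights
      remain.\<close>
    have eq: "A / (A + B) * (A powr p / A powr p) + B / (A + B) * (B powr p / B powr p) = 1"
      using 3 by (simp flip: add_divide_distrib)
    have "(\<Sum>i. (a i + b i) powr p) \<le> (A + B) powr p * 1"
    proof (rule sums_le)
      show "(\<lambda>i. (a i + b i) powr p) sums (\<Sum>i. (a i + b i) powr p)"
        using assms by (intro summable_sums summable_powr_add) auto
      show "(\<lambda>i. (A + B) powr p * (A / (A + B) * (a i powr p / A powr p) +
          B / (A + B) * (b i powr p / B powr p))) sums ((A + B) powr p * 1)"
        using sums_mult[OF sums_add[OF sA sB], of "(A + B) powr p"] unfolding eq .
    qed (use assms 3 in \<open>intro powr_add_le_convex\<close>)
    then show ?thesis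
      using 3 assms by (subst powr_le_iff_le_powr_inverse) (auto intro!: suminf_nonneg summable_powr_add)
  qed
  then show ?thesis by (simp add: A_def B_def)
qed

section \<open>Radii and centers in a normed space\<close>

context real_normed_space
begin

lemma vnorm_zero [simp]: "vnorm X \<zero> = 0"
  by (simp add: vnorm_eq_0_iff)

lemma vnorm_minus_commute:
  "\<lbrakk>x \<in> carrier X; y \<in> carrier X\<rbrakk> \<Longrightarrow> vnorm X (x \<ominus> y) = vnorm X (y \<ominus> x)"
  using Metric_space.commute[OF Metric_space_vdist, of x y] by (simp add: vdist_def)

lemma vnorm_minus_triangle:
  "\<lbrakk>x \<in> carrier X; y \<in> carrier X; z \<in> carrier X\<rbrakk>
    \<Longrightarrow> vnorm X (x \<ominus> z) \<le> vnorm X (x \<ominus> y) + vnorm X (y \<ominus> z)"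
  using Metric_space.triangle[OF Metric_space_vdist, of x y z] by (simp add: vdist_def)

lemma vnorm_le_minus:
  "\<lbrakk>x \<in> carrier X; y \<in> carrier X\<rbrakk> \<Longrightarrow> vnorm X x \<le> vnorm X (x \<ominus> y) + vnorm X y"
  using vnorm_triangle[of "x \<ominus> y" y] by (simp add: a_minus_def M.a_assoc M.l_neg)

lemma CB_subset: "F \<in> CB X \<Longrightarrow> F \<subseteq> carrier X"
  using Metric_space.closedin_metric[OF Metric_space_vdist] by (auto simp: CB_def)

lemma CB_nonempty: "F \<in> CB X \<Longrightarrow> F \<noteq> {}"
  by (simp add: CB_def)

text \<open>A real supremum is informative only for a nonempty set bounded above. A ball containing
  \<open>F\<close> and the triangle inequality supply the bound.\<close>

lemma CB_bdd_above:
  assumes "F \<in> CB X" "x \<in> carrier X"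
  shows "bdd_above ((\<lambda>a. vnorm X (x \<ominus> a)) ` F)"
proof -
  interpret Metric_space "carrier X" "vdist X" by (rule Metric_space_vdist)
  obtain c B where c: "F \<subseteq> mcball c B"
    using assms by (auto simp: CB_def mbounded_def)
  show ?thesis
  proof (rule bdd_aboveI2)
    fix a assume "a \<in> F"
    then have "c \<in> carrier X" "a \<in> carrier X" "vdist X c a \<le> B" using c by auto
    then show "vnorm X (x \<ominus> a) \<le> vnorm X (x \<ominus> c) + B"
      using vnorm_minus_triangle[of x c a] assms by (simp add: vdist_def)
  qed
qed

lemma vnorm_le_radius:
  "\<lbrakk>F \<in> CB X; x \<in> carrier X; a \<in> F\<rbrakk> \<Longrightarrow> vnorm X (x \<ominus> a) \<le> radius X x F"
  unfolding radius_def by (intro cSUP_upper CB_bdd_above)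

lemma radius_nonneg:
  assumes "F \<in> CB X" "x \<in> carrier X"
  shows "0 \<le> radius X x F"
proof -
  obtain a where "a \<in> F" using CB_nonempty assms by auto
  moreover have "a \<in> carrier X" using CB_subset assms calculation by auto
  ultimately show ?thesis
    using vnorm_le_radius[of F x a] vnorm_nonneg[of "x \<ominus> a"] assms by simp
qed

lemma radius_le:
  "\<lbrakk>F \<in> CB X; \<And>a. a \<in> F \<Longrightarrow> vnorm X (x \<ominus> a) \<le> r\<rbrakk> \<Longrightarrow> radius X x F \<le> r"
  unfolding radius_def by (intro cSUP_least CB_nonempty)

lemma radius_approx:
  assumes "F \<in> CB X" "x \<in> carrier X" "e > 0"
  shows "\<exists>a\<in>F. radius X x F - e < vnorm X (x \<ominus> a)"
  using less_cSUP_iff[OF CB_nonempty CB_bdd_above, of F x "radius X x F - e"] assms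
  by (simp add: radius_def)

text \<open>Triangle inequality through any point of \<open>F\<close>. It controls the distance to a
  center where no better estimate is at hand.\<close>

lemma vnorm_minus_le_radius_add:
  assumes F: "F \<in> CB X" and xy: "x \<in> carrier X" "y \<in> carrier X"
  shows "vnorm X (x \<ominus> y) \<le> radius X x F + radius X y F"
proof -
  obtain a where a: "a \<in> F" using CB_nonempty F by auto
  then have "a \<in> carrier X" using CB_subset F by auto
  then show ?thesis
    using vnorm_minus_triangle[of x a y] vnorm_minus_commute[of a y] xy
      vnorm_le_radius[OF F _ a, of x] vnorm_le_radius[OF F _ a, of y] by simp
qed

lemma cheb_rad_le_radius:
  assumes "F \<in> CB X" "V \<subseteq> carrier X" "v \<in> V"
  shows "cheb_rad X V F \<le> radius X v F"
  unfolding cheb_rad_def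
  using assms by (intro cINF_lower bdd_belowI2[of _ 0]) (auto intro: radius_nonneg)

lemma le_cheb_rad:
  "\<lbrakk>V \<noteq> {}; \<And>v. v \<in> V \<Longrightarrow> r \<le> radius X v F\<rbrakk> \<Longrightarrow> r \<le> cheb_rad X V F"
  unfolding cheb_rad_def by (intro cINF_greatest)

lemma cheb_rad_nonneg:
  "\<lbrakk>F \<in> CB X; V \<subseteq> carrier X; V \<noteq> {}\<rbrakk> \<Longrightarrow> 0 \<le> cheb_rad X V F"
  by (intro le_cheb_rad) (auto intro: radius_nonneg)

lemma cheb_rad_approx:
  assumes "V \<noteq> {}" "e > 0"
  shows "\<exists>v\<in>V. radius X v F < cheb_rad X V F + e"
proof (rule ccontr)
  assume "\<not> ?thesis"
  then have "cheb_rad X V F + e \<le> cheb_rad X V F"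
    using assms by (intro le_cheb_rad) (auto simp: not_less)
  then show False using assms by simp
qed

section \<open>The property in terms of distances\<close>

lemma vnorm_le_iff_mem_unit_ball:
  assumes "x \<in> carrier X" "\<epsilon> > 0"
  shows "x \<in> (\<lambda>b. \<epsilon> \<odot> b) ` unit_ball X \<longleftrightarrow> vnorm X x \<le> \<epsilon>"
proof
  assume "x \<in> (\<lambda>b. \<epsilon> \<odot> b) ` unit_ball X"
  then show "vnorm X x \<le> \<epsilon>"
    using assms by (auto simp: unit_ball_def vnorm_smult)
next
  assume *: "vnorm X x \<le> \<epsilon>"
  have "x = \<epsilon> \<odot> ((1 / \<epsilon>) \<odot> x)"
    using assms smult_assoc1[of \<epsilon> "1 / \<epsilon>" x] smult_one[of x] by (simp add: real_ring_def)
  moreover have "(1 / \<epsilon>) \<odot> x \<in> unit_ball X"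
    using assms * smult_closed[of "1 / \<epsilon>" x]
    by (simp add: unit_ball_def vnorm_smult real_ring_def)
  ultimately show "x \<in> (\<lambda>b. \<epsilon> \<odot> b) ` unit_ball X" by blast
qed

lemma mem_set_add_ball_iff:
  assumes Z: "Z \<subseteq> carrier X" and y: "y \<in> carrier X" and e: "\<epsilon> > 0"
  shows "y \<in> Z <+> (\<lambda>b. \<epsilon> \<odot> b) ` unit_ball X \<longleftrightarrow> (\<exists>z\<in>Z. vnorm X (y \<ominus> z) \<le> \<epsilon>)"
proof
  assume "y \<in> Z <+> (\<lambda>b. \<epsilon> \<odot> b) ` unit_ball X"
  then obtain z b where zb: "z \<in> Z" "b \<in> (\<lambda>b. \<epsilon> \<odot> b) ` unit_ball X" "y = z \<oplus> b"
    unfolding set_add_def' by blast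
  have b: "b \<in> carrier X"
    using zb smult_closed[of \<epsilon>] by (auto simp: unit_ball_def real_ring_def)
  have "y \<ominus> z = b"
    using zb b Z by (auto simp: a_minus_def M.a_ac M.r_neg2 M.r_neg1 M.a_comm[of z b] M.r_neg subset_iff)
  then show "\<exists>z\<in>Z. vnorm X (y \<ominus> z) \<le> \<epsilon>"
    using zb b vnorm_le_iff_mem_unit_ball[OF b e] by blast
next
  assume "\<exists>z\<in>Z. vnorm X (y \<ominus> z) \<le> \<epsilon>"
  then obtain z where z: "z \<in> Z" "vnorm X (y \<ominus> z) \<le> \<epsilon>" by blast
  have zc: "z \<in> carrier X" using z Z by auto
  have "y \<ominus> z \<in> (\<lambda>b. \<epsilon> \<odot> b) ` unit_ball X"
    using vnorm_le_iff_mem_unit_ball[of "y \<ominus> z"] z zc y e by simp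
  moreover have "y = z \<oplus> (y \<ominus> z)"
    using zc y by (simp add: a_minus_def M.a_lcomm[of z y] M.r_neg)
  ultimately show "y \<in> Z <+> (\<lambda>b. \<epsilon> \<odot> b) ` unit_ball X"
    unfolding set_add_def' using z by blast
qed

text \<open>Trades the sum with a scaled ball for a distance estimate, the form in which both
  directions of the theorem handle the property.\<close>

lemma property_P1_iff:
  assumes "V \<subseteq> carrier X"
  shows "property_P1 X V F \<longleftrightarrow> cheb_centers X V F \<noteq> {} \<and>
    (\<forall>\<epsilon>>0. \<exists>\<delta>>0. \<forall>y\<in>near_centers X V F \<delta>. \<exists>z\<in>cheb_centers X V F. vnorm X (y \<ominus> z) \<le> \<epsilon>)"
proof -
  have "cheb_centers X V F \<subseteq> carrier X" "\<And>\<delta>. near_centers X V F \<delta> \<subseteq> carrier X"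
    using assms by (auto simp: cheb_centers_def near_centers_def)
  then show ?thesis
    unfolding property_P1_def by (simp add: subset_iff mem_set_add_ball_iff Ball_def)
qed

end

section \<open>The direct sum\<close>

lemma smult_real_ring:
  assumes "real_normed_space X" "x \<in> carrier X"
  shows "smult X a x \<in> carrier X"
  using assms module.smult_closed[of real_ring X a x]
  by (simp add: real_normed_space_def real_ring_def)

locale lp_family =
  fixes X :: "nat \<Rightarrow> 'a normed_space" and p :: real
  assumes rns: "\<And>i. real_normed_space (X i)"
    and p_ge_1: "1 \<le> p"
begin

abbreviation "S \<equiv> lp_sum p X"

lemma p_pos: "0 < p" using p_ge_1 by simp

lemma carrier_lp: "x \<in> carrier S \<longleftrightarrow>
    (\<forall>i. x i \<in> carrier (X i)) \<and> summable (\<lambda>i. vnorm (X i) (x i) powr p)"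
  by (simp add: lp_sum_def)

lemma vnorm_lp: "vnorm S x = (\<Sum>i. vnorm (X i) (x i) powr p) powr (1 / p)"
  by (simp add: lp_sum_def)

lemma carrier_lpD: "x \<in> carrier S \<Longrightarrow> x i \<in> carrier (X i)"
  by (simp add: carrier_lp)

lemma summable_lpD: "x \<in> carrier S \<Longrightarrow> summable (\<lambda>i. vnorm (X i) (x i) powr p)"
  by (simp add: carrier_lp)

text \<open>Comparison test: membership in the sum follows from a p-summable bound on the coordinate
  norms.\<close>

lemma carrier_lp_dominated:
  assumes "\<And>i. x i \<in> carrier (X i)" "summable (\<lambda>i. g i powr p)" "\<And>i. vnorm (X i) (x i) \<le> g i"
  shows "x \<in> carrier S"
  unfolding carrier_lp
proof (intro conjI allI)
  show "summable (\<lambda>i. vnorm (X i) (x i) powr p)"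
  proof (rule summable_comparison_test'[OF assms(2)])
    show "norm (vnorm (X i) (x i) powr p) \<le> g i powr p" for i
      using assms real_normed_space.vnorm_nonneg[OF rns assms(1)] p_pos
      by (simp add: powr_mono2)
  qed
qed (rule assms)

lemma add_closed: "\<lbrakk>x \<in> carrier S; y \<in> carrier S\<rbrakk> \<Longrightarrow> x \<oplus>\<^bsub>S\<^esub> y \<in> carrier S"
proof -
  assume xy: "x \<in> carrier S" "y \<in> carrier S"
  interpret X: real_normed_space "X i" for i by (rule rns)
  have xi: "x i \<in> carrier (X i)" and yi: "y i \<in> carrier (X i)" for i
    using xy by (simp_all add: carrier_lp)
  show ?thesis
  proof (rule carrier_lp_dominated)
    show "summable (\<lambda>i. (vnorm (X i) (x i) + vnorm (X i) (y i)) powr p)"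
      using p_pos by (intro summable_powr_add summable_lpD xy X.vnorm_nonneg xi yi) auto
  qed (use X.vnorm_triangle xi yi in \<open>auto simp: lp_sum_def\<close>)
qed

lemma uminus_mem: "x \<in> carrier S \<Longrightarrow> (\<lambda>i. \<ominus>\<^bsub>X i\<^esub> x i) \<in> carrier S"
proof -
  assume x: "x \<in> carrier S"
  interpret X: real_normed_space "X i" for i by (rule rns)
  show ?thesis
    using x by (simp add: carrier_lp X.vnorm_minus)
qed

lemma abelian_group_lp: "abelian_group S"
proof -
  interpret X: real_normed_space "X i" for i by (rule rns)
  show ?thesis
  proof (rule abelian_groupI)
    show "\<exists>y\<in>carrier S. y \<oplus>\<^bsub>S\<^esub> x = \<zero>\<^bsub>S\<^esub>" if x: "x \<in> carrier S" for x
      using carrier_lpD[OF x]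
      by (intro bexI[OF _ uminus_mem[OF x]]) (simp add: lp_sum_def X.M.l_neg)
    show "\<zero>\<^bsub>S\<^esub> \<in> carrier S"
      using p_pos by (simp add: lp_sum_def)
  qed (simp_all only: add_closed, auto simp: lp_sum_def X.M.a_ac)
qed

text \<open>The inverse in \<open>S\<close> comes from its additive group rather than from a
  coordinate formula, so uniqueness of inverses identifies it with the coordinatewise one.\<close>

lemma minus_lp:
  assumes "x \<in> carrier S" "y \<in> carrier S"
  shows "(x \<ominus>\<^bsub>S\<^esub> y) i = x i \<ominus>\<^bsub>X i\<^esub> y i"
proof -
  interpret X: real_normed_space "X i" for i by (rule rns)
  have "\<ominus>\<^bsub>S\<^esub> y = (\<lambda>i. \<ominus>\<^bsub>X i\<^esub> y i)"
  proof (rule abelian_group.minus_equality[OF abelian_group_lp])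
    show "(\<lambda>i. \<ominus>\<^bsub>X i\<^esub> y i) \<oplus>\<^bsub>S\<^esub> y = \<zero>\<^bsub>S\<^esub>"
      using carrier_lpD[OF assms(2)] by (simp add: lp_sum_def X.M.l_neg)
  qed (use assms uminus_mem in auto)
  then show ?thesis
    by (simp add: a_minus_def) (simp add: lp_sum_def)
qed

lemma vnorm_smult_powr:
  "x \<in> carrier S \<Longrightarrow>
    vnorm (X i) (c \<odot>\<^bsub>X i\<^esub> x i) powr p = \<bar>c\<bar> powr p * vnorm (X i) (x i) powr p"
  using real_normed_space.vnorm_smult[OF rns carrier_lpD, of x i c]
  by (simp add: powr_mult)

lemma smult_closed: "x \<in> carrier S \<Longrightarrow> c \<odot>\<^bsub>S\<^esub> x \<in> carrier S"
proof -
  assume x: "x \<in> carrier S"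
  have "summable (\<lambda>i. vnorm (X i) (c \<odot>\<^bsub>X i\<^esub> x i) powr p)"
    unfolding vnorm_smult_powr[OF x] by (intro summable_mult summable_lpD x)
  then show ?thesis
    using smult_real_ring[OF rns carrier_lpD[OF x]] by (simp add: lp_sum_def)
qed

text \<open>Makes the facts on radii and centers available for \<open>S\<close> itself. The triangle
  inequality combines the coordinatewise ones with Minkowski's.\<close>

sublocale real_normed_space S
proof -
  interpret X: real_normed_space "X i" for i by (rule rns)
  show "real_normed_space S"
  proof (intro real_normed_space.intro moduleI real_normed_space_axioms.intro
      cring_real_ring abelian_group_lp)
    fix x y and a b :: real
    assume x: "x \<in> carrier S"
    note xi = carrier_lpD[OF x]
    show "a \<odot>\<^bsub>S\<^esub> x \<in> carrier S" by (rule smult_closed[OF x])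
    show "(a \<oplus>\<^bsub>real_ring\<^esub> b) \<odot>\<^bsub>S\<^esub> x = a \<odot>\<^bsub>S\<^esub> x \<oplus>\<^bsub>S\<^esub> b \<odot>\<^bsub>S\<^esub> x"
      using X.smult_l_distr[of a b] xi by (simp add: lp_sum_def real_ring_def)
    show "(a \<otimes>\<^bsub>real_ring\<^esub> b) \<odot>\<^bsub>S\<^esub> x = a \<odot>\<^bsub>S\<^esub> (b \<odot>\<^bsub>S\<^esub> x)"
      using X.smult_assoc1[of a b] xi by (simp add: lp_sum_def real_ring_def)
    show "\<one>\<^bsub>real_ring\<^esub> \<odot>\<^bsub>S\<^esub> x = x"
      using X.smult_one xi by (simp add: lp_sum_def)
    show "vnorm S x = 0 \<longleftrightarrow> x = \<zero>\<^bsub>S\<^esub>"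
      using suminf_eq_zero_iff[OF summable_lpD[OF x]] xi
      by (auto simp: vnorm_lp X.vnorm_eq_0_iff lp_sum_def fun_eq_iff)
    show "vnorm S (a \<odot>\<^bsub>S\<^esub> x) = \<bar>a\<bar> * vnorm S x"
    proof -
      have "vnorm S (a \<odot>\<^bsub>S\<^esub> x) = (\<Sum>i. vnorm (X i) (a \<odot>\<^bsub>X i\<^esub> x i) powr p) powr (1 / p)"
        by (simp add: lp_sum_def)
      also have "\<dots> = (\<bar>a\<bar> powr p * (\<Sum>i. vnorm (X i) (x i) powr p)) powr (1 / p)"
        unfolding vnorm_smult_powr[OF x] by (simp add: suminf_mult summable_lpD[OF x])
      finally show ?thesis
        using p_pos summable_lpD[OF x] by (simp add: vnorm_lp powr_mult powr_powr suminf_nonneg)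
    qed
    assume y: "y \<in> carrier S"
    note yi = carrier_lpD[OF y]
    show "a \<odot>\<^bsub>S\<^esub> (x \<oplus>\<^bsub>S\<^esub> y) = a \<odot>\<^bsub>S\<^esub> x \<oplus>\<^bsub>S\<^esub> a \<odot>\<^bsub>S\<^esub> y"
      using X.smult_r_distr[of a] xi yi by (simp add: lp_sum_def real_ring_def)
    show "vnorm S (x \<oplus>\<^bsub>S\<^esub> y) \<le> vnorm S x + vnorm S y"
    proof -
      have "vnorm S (x \<oplus>\<^bsub>S\<^esub> y) \<le>
          (\<Sum>i. (vnorm (X i) (x i) + vnorm (X i) (y i)) powr p) powr (1 / p)"
        using summable_lpD[OF add_closed[OF x y]] summable_lpD[OF x] summable_lpD[OF y]
          X.vnorm_nonneg[OF xi] X.vnorm_nonneg[OF yi] X.vnorm_triangle[OF xi yi]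
          X.vnorm_nonneg[OF carrier_lpD[OF add_closed[OF x y]]] p_pos
        unfolding vnorm_lp
        by (intro powr_mono2 suminf_le suminf_nonneg summable_powr_add)
          (auto simp: lp_sum_def)
      also have "\<dots> \<le> vnorm S x + vnorm S y"
        unfolding vnorm_lp using X.vnorm_nonneg[OF xi] X.vnorm_nonneg[OF yi] p_ge_1 summable_lpD[OF x] summable_lpD[OF y]
        by (intro Minkowski_suminf) auto
      finally show ?thesis .
    qed
  qed
qed

lemma vnorm_powr_lp: "x \<in> carrier S \<Longrightarrow> vnorm S x powr p = (\<Sum>i. vnorm (X i) (x i) powr p)"
  using p_pos summable_lpD[of x] by (simp add: vnorm_lp powr_powr suminf_nonneg)

lemma vnorm_component_le:
  assumes "x \<in> carrier S"
  shows "vnorm (X i) (x i) \<le> vnorm S x"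
proof (subst powr_le_powr_iff[where p = p, symmetric])
  show "vnorm (X i) (x i) powr p \<le> vnorm S x powr p"
    using sum_le_suminf[OF summable_lpD[OF assms], of "{i}"] by (simp add: vnorm_powr_lp assms)
qed (use p_pos vnorm_nonneg[OF assms] real_normed_space.vnorm_nonneg[OF rns carrier_lpD[OF assms]] in auto)

end

section \<open>Products of bounded sets\<close>

text \<open>\<open>CB_Pi\<close> is a separate assumption because a product of bounded sets need not
  lie in the direct sum.\<close>

locale lp_family_CB = lp_family X p for X :: "nat \<Rightarrow> 'a normed_space" and p +
  fixes F :: "nat \<Rightarrow> 'a set"
  assumes CB_component: "\<And>i. F i \<in> CB (X i)"
    and CB_Pi: "Pi UNIV F \<in> CB S"
begin

abbreviation (input) "r \<equiv> \<lambda>i v. radius (X i) v (F i)"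

lemma radius_component_nonneg: "v \<in> carrier (X i) \<Longrightarrow> 0 \<le> r i v"
  by (intro real_normed_space.radius_nonneg rns CB_component)

text \<open>Points of a product may be chosen independently in each coordinate, so almost farthest
  points in all coordinates form one almost farthest point. This gives one inequality; bounding each
  coordinate by its own radius gives the other.\<close>

lemma radius_powr_sums:
  assumes x: "x \<in> carrier S"
  shows "(\<lambda>i. r i (x i) powr p) sums (radius S x (Pi UNIV F) powr p)"
proof -
  interpret X: real_normed_space "X i" for i by (rule rns)
  define R where "R = radius S x (Pi UNIV F)"
  note xi = carrier_lpD[OF x]
  have R0: "0 \<le> R" unfolding R_def by (rule radius_nonneg[OF CB_Pi x])
  have bound: "(\<Sum>i<n. r i (x i) powr p) \<le> R powr p" for n
  proof -
    \<comment> \<open>For each \<open>k\<close>, one point of the whole product comes within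
      \<open>1 / real (Suc k)\<close> of the radius in every coordinate at once.\<close>
    have "\<forall>k i. \<exists>a. a \<in> F i \<and> r i (x i) - 1 / real (Suc k) < vnorm (X i) (x i \<ominus>\<^bsub>X i\<^esub> a)"
      using X.radius_approx[OF CB_component xi] by (auto simp: Bex_def)
    then obtain a where a: "\<And>k i. a k i \<in> F i"
      "\<And>k i. r i (x i) - 1 / real (Suc k) < vnorm (X i) (x i \<ominus>\<^bsub>X i\<^esub> a k i)"
      unfolding choice_iff by blast
    have aP: "a k \<in> Pi UNIV F" for k using a by auto
    have aS: "a k \<in> carrier S" for k using aP CB_subset[OF CB_Pi] by blast
    have lim: "(\<lambda>k. vnorm (X i) (x i \<ominus>\<^bsub>X i\<^esub> a k i)) \<longlonglongrightarrow> r i (x i)" for i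
    proof (rule tendsto_sandwich)
      have "(\<lambda>k. r i (x i) - inverse (real (Suc k))) \<longlonglongrightarrow> r i (x i) - 0"
        by (intro tendsto_intros LIMSEQ_inverse_real_of_nat)
      then show "(\<lambda>k. r i (x i) - 1 / real (Suc k)) \<longlonglongrightarrow> r i (x i)"
        by (simp add: inverse_eq_divide)
      show "\<forall>\<^sub>F k in sequentially. r i (x i) - 1 / real (Suc k) \<le> vnorm (X i) (x i \<ominus>\<^bsub>X i\<^esub> a k i)"
        using a by (intro always_eventually allI less_imp_le)
      show "\<forall>\<^sub>F k in sequentially. vnorm (X i) (x i \<ominus>\<^bsub>X i\<^esub> a k i) \<le> r i (x i)"
        by (intro always_eventually allI X.vnorm_le_radius CB_component xi a)
    qed simp
    \<comment> \<open>Only finitely many coordinates are summed, so the limit in \<open>k\<close>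
      passes through the sum.\<close>
    have "(\<lambda>k. \<Sum>i<n. vnorm (X i) (x i \<ominus>\<^bsub>X i\<^esub> a k i) powr p) \<longlonglongrightarrow> (\<Sum>i<n. r i (x i) powr p)"
    \<comment> \<open>A coordinate radius may be 0, so \<open>disjI2\<close> selects continuity of
      the power through nonnegative bases and a positive exponent.\<close>
    proof (intro tendsto_sum tendsto_powr' tendsto_const lim disjI2 conjI)
      show "\<forall>\<^sub>F k in sequentially. 0 \<le> vnorm (X i) (x i \<ominus>\<^bsub>X i\<^esub> a k i)" for i
        using carrier_lpD[OF aS] xi by (intro always_eventually allI X.vnorm_nonneg) auto
    qed (use p_pos in auto)
    then show ?thesis
    proof (rule LIMSEQ_le_const2, intro exI allI impI)
      fix k
      have d: "x \<ominus>\<^bsub>S\<^esub> a k \<in> carrier S" using x aS by simp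
      have "(\<Sum>i<n. vnorm (X i) (x i \<ominus>\<^bsub>X i\<^esub> a k i) powr p) \<le> vnorm S (x \<ominus>\<^bsub>S\<^esub> a k) powr p"
        using sum_le_suminf[OF summable_lpD[OF d], of "{..<n}"]
        by (simp add: vnorm_powr_lp[OF d] minus_lp[OF x aS])
      also have "\<dots> \<le> R powr p"
        unfolding R_def using p_pos
        by (intro powr_mono2 vnorm_le_radius[OF CB_Pi x aP] vnorm_nonneg d) auto
      finally show "(\<Sum>i<n. vnorm (X i) (x i \<ominus>\<^bsub>X i\<^esub> a k i) powr p) \<le> R powr p" .
    qed
  qed
  have sm: "summable (\<lambda>i. r i (x i) powr p)"
    using bound by (intro summableI_nonneg_bounded) auto
  have le: "(\<Sum>i. r i (x i) powr p) \<le> R powr p"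
    using bound by (intro suminf_le_const sm)
  \<comment> \<open>The opposite inequality: every point of the product is bounded term by term by
    the coordinate radii.\<close>
  have "R \<le> (\<Sum>i. r i (x i) powr p) powr (1 / p)"
    unfolding R_def
  proof (rule radius_le[OF CB_Pi])
    fix a assume a: "a \<in> Pi UNIV F"
    then have aS: "a \<in> carrier S" using CB_subset[OF CB_Pi] by blast
    have d: "x \<ominus>\<^bsub>S\<^esub> a \<in> carrier S" using x aS by simp
    show "vnorm S (x \<ominus>\<^bsub>S\<^esub> a) \<le> (\<Sum>i. r i (x i) powr p) powr (1 / p)"
      unfolding vnorm_lp using p_pos
    proof (intro powr_mono2 suminf_le sm summable_lpD[OF d] suminf_nonneg)
      show "vnorm (X i) ((x \<ominus>\<^bsub>S\<^esub> a) i) \<le> r i (x i)" for i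
        using a unfolding minus_lp[OF x aS] by (intro X.vnorm_le_radius CB_component xi) auto
      show "0 \<le> vnorm (X i) ((x \<ominus>\<^bsub>S\<^esub> a) i)" for i
        by (intro X.vnorm_nonneg carrier_lpD[OF d])
    qed auto
  qed
  then have "R powr p \<le> ((\<Sum>i. r i (x i) powr p) powr (1 / p)) powr p"
    using R0 p_pos by (intro powr_mono2) auto
  also have "\<dots> = (\<Sum>i. r i (x i) powr p)"
    using p_pos sm by (simp add: powr_powr suminf_nonneg)
  finally show ?thesis
    using le sm unfolding R_def[symmetric] by (simp add: sums_iff)
qed

text \<open>Against a fixed point \<open>a\<close> of the product, the norm of \<open>y i\<close> is
  at most its radius plus the norm of \<open>a i\<close>, and both are p-summable.\<close>

lemma carrier_lp_if_radius_summable: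
  assumes y: "\<And>i. y i \<in> carrier (X i)" and sm: "summable (\<lambda>i. r i (y i) powr p)"
  shows "y \<in> carrier S"
proof -
  interpret X: real_normed_space "X i" for i by (rule rns)
  obtain a where a: "a \<in> Pi UNIV F" using CB_nonempty[OF CB_Pi] unfolding ex_in_conv[symmetric] ..
  then have aS: "a \<in> carrier S" using CB_subset[OF CB_Pi] by (rule subsetD[rotated])
  show ?thesis
  proof (rule carrier_lp_dominated[OF y])
    show "summable (\<lambda>i. (r i (y i) + vnorm (X i) (a i)) powr p)"
      using p_pos carrier_lpD[OF aS] y
      by (intro summable_powr_add sm summable_lpD aS X.vnorm_nonneg X.radius_nonneg CB_component) auto
    show "vnorm (X i) (y i) \<le> r i (y i) + vnorm (X i) (a i)" for i
      using X.vnorm_le_minus[OF y carrier_lpD[OF aS], of i]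
        X.vnorm_le_radius[OF CB_component y, of "a i" i] a by (simp add: Pi_iff)
  qed
qed

end

section \<open>Radius and centers relative to the sum of the subspaces\<close>

locale lp_family_CB_sub = lp_family_CB X p F for X :: "nat \<Rightarrow> 'a normed_space" and p F +
  fixes Y :: "nat \<Rightarrow> 'a set"
  assumes Y_subset: "\<And>i. Y i \<subseteq> carrier (X i)"
    and Y_zero: "\<And>i. \<zero>\<^bsub>X i\<^esub> \<in> Y i"
begin

abbreviation "T \<equiv> lp_sum_sub p X Y"
abbreviation "PF \<equiv> Pi UNIV F"
abbreviation (input) "\<rho> \<equiv> \<lambda>i. cheb_rad (X i) (Y i) (F i)"

lemma mem_T_iff: "y \<in> T \<longleftrightarrow> y \<in> carrier S \<and> (\<forall>i. y i \<in> Y i)"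
  using Y_subset by (auto simp: lp_sum_sub_def lp_sum_def)

lemma T_subset: "T \<subseteq> carrier S"
  by (auto simp: mem_T_iff)

lemma zero_mem_T: "\<zero>\<^bsub>S\<^esub> \<in> T"
  using M.zero_closed Y_zero by (simp add: mem_T_iff) (simp add: lp_sum_def)

lemma T_nonempty: "T \<noteq> {}"
  using zero_mem_T by auto

lemma \<rho>_nonneg: "0 \<le> \<rho> i"
  using Y_zero by (intro real_normed_space.cheb_rad_nonneg[OF rns CB_component Y_subset]) auto

lemma \<rho>_le: "v \<in> Y i \<Longrightarrow> \<rho> i \<le> r i v"
  by (intro real_normed_space.cheb_rad_le_radius[OF rns CB_component Y_subset])

lemma radius_nonneg_Y: "v \<in> Y i \<Longrightarrow> 0 \<le> r i v"
  using radius_component_nonneg Y_subset by blast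

lemma \<rho>_powr_le: "v \<in> Y i \<Longrightarrow> \<rho> i powr p \<le> r i v powr p"
  using \<rho>_le \<rho>_nonneg p_pos by (intro powr_mono2) auto

text \<open>The zero vector lies in \<open>T\<close>, and its coordinate radii dominate the \<rho>
  terms.\<close>

lemma summable_\<rho>: "summable (\<lambda>i. \<rho> i powr p)"
proof (rule summable_comparison_test')
  show "summable (\<lambda>i. r i (\<zero>\<^bsub>S\<^esub> i) powr p)"
    using radius_powr_sums[of "\<zero>\<^bsub>S\<^esub>"] by (simp add: sums_iff)
  show "norm (\<rho> i powr p) \<le> r i (\<zero>\<^bsub>S\<^esub> i) powr p" for i
    using \<rho>_powr_le[of "\<zero>\<^bsub>S\<^esub> i" i] zero_mem_T by (simp add: mem_T_iff)
qed

text \<open>Lets coordinatewise choices be assembled into a point of \<open>T\<close>. It is applied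
  with zero excess, geometric excess, and excess in a single coordinate.\<close>

lemma mem_T_if_powr_le:
  assumes "\<And>i. y i \<in> Y i" "summable e" "\<And>i. r i (y i) powr p \<le> \<rho> i powr p + e i"
  shows "y \<in> T"
proof -
  have "summable (\<lambda>i. r i (y i) powr p)"
    by (rule summable_comparison_test'[OF summable_add[OF summable_\<rho> assms(2)]]) (use assms(3) in simp)
  then show ?thesis
    using assms Y_subset carrier_lp_if_radius_summable[of y] by (auto simp: mem_T_iff)
qed

text \<open>The series bounds the p-th power of the radius at every point of \<open>T\<close> from
  below, and coordinatewise almost minimisers with summable excess show that it is attained up to
  any \<open>e\<close>.\<close>

lemma cheb_rad_powr_sums: "(\<lambda>i. \<rho> i powr p) sums (cheb_rad S T PF powr p)"
proof -
  define R where "R = cheb_rad S T PF"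
  define s where "s = (\<Sum>i. \<rho> i powr p)"
  have R0: "0 \<le> R"
    unfolding R_def by (rule cheb_rad_nonneg[OF CB_Pi T_subset T_nonempty])
  have s0: "0 \<le> s"
    unfolding s_def by (intro suminf_nonneg summable_\<rho>) auto
  have "s powr (1 / p) \<le> R"
    unfolding R_def
  proof (rule le_cheb_rad[OF T_nonempty])
    fix v assume v: "v \<in> T"
    then have vS: "v \<in> carrier S" using T_subset by auto
    have "s \<le> radius S v PF powr p"
      unfolding s_def using v
      by (intro sums_le[OF _ summable_sums[OF summable_\<rho>] radius_powr_sums[OF vS]] \<rho>_powr_le)
        (simp add: mem_T_iff)
    then show "s powr (1 / p) \<le> radius S v PF"
      using radius_nonneg[OF CB_Pi vS] s0 p_pos by (subst powr_le_iff_le_powr_inverse) auto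
  qed
  then have 1: "s \<le> R powr p"
    using s0 R0 p_pos powr_le_iff_le_powr_inverse by blast
  have "R powr p \<le> s + e" if e: "e > 0" for e
  proof -
    \<comment> \<open>The allowances \<open>e * (1 / 2) ^ Suc i\<close> add up to exactly
      \<open>e\<close>.\<close>
    have "\<exists>v\<in>Y i. r i v powr p \<le> \<rho> i powr p + e * (1 / 2) ^ Suc i" for i
    proof -
      obtain d where d: "0 < d" "(\<rho> i + d) powr p \<le> \<rho> i powr p + e * (1 / 2) ^ Suc i"
        using powr_add_le_ex[OF \<rho>_nonneg p_pos, of "e * (1 / 2) ^ Suc i" i] e by auto
      obtain v where v: "v \<in> Y i" "r i v < \<rho> i + d"
        using real_normed_space.cheb_rad_approx[OF rns _ d(1), of "Y i"] Y_zero[of i] by blast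
      have "r i v powr p \<le> (\<rho> i + d) powr p"
        using v(2) p_pos radius_nonneg_Y[OF v(1)] by (intro powr_mono2) auto
      then show ?thesis using v d by force
    qed
    then obtain y where y: "\<And>i. y i \<in> Y i"
      "\<And>i. r i (y i) powr p \<le> \<rho> i powr p + e * (1 / 2) ^ Suc i" by metis
    have es: "(\<lambda>i. e * (1 / 2) ^ Suc i) sums (e * 1)"
      by (intro sums_mult power_half_series)
    have yT: "y \<in> T"
      by (rule mem_T_if_powr_le[OF y(1) sums_summable[OF es] y(2)])
    then have yS: "y \<in> carrier S" using T_subset by auto
    have "R powr p \<le> radius S y PF powr p"
      using R0 p_pos cheb_rad_le_radius[OF CB_Pi T_subset yT] unfolding R_def
      by (intro powr_mono2) auto
    also have "\<dots> \<le> s + e * 1"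
      unfolding s_def
      by (rule sums_le[OF y(2) radius_powr_sums[OF yS] sums_add[OF summable_sums[OF summable_\<rho>] es]])
    finally show ?thesis by simp
  qed
  then have "R powr p \<le> s" by (rule field_le_epsilon)
  with 1 show ?thesis
    using summable_\<rho> by (simp add: R_def s_def sums_iff)
qed

text \<open>The terms are nonnegative for \<open>y\<close> in \<open>T\<close>, so the total excess
  bounds the excess in each coordinate.\<close>

lemma excess_sums:
  assumes "y \<in> T"
  shows "(\<lambda>i. r i (y i) powr p - \<rho> i powr p) sums
    (radius S y PF powr p - cheb_rad S T PF powr p)"
  using assms T_subset by (intro sums_diff radius_powr_sums cheb_rad_powr_sums) auto

lemma cheb_rad_S_nonneg: "0 \<le> cheb_rad S T PF"
  by (rule cheb_rad_nonneg[OF CB_Pi T_subset T_nonempty])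

text \<open>A total excess of zero with nonnegative terms forces every term to vanish. Conversely, a
  sequence of centers has zero excess, which also places it in \<open>T\<close>.\<close>

lemma cheb_centers_iff:
  "y \<in> cheb_centers S T PF \<longleftrightarrow> (\<forall>i. y i \<in> cheb_centers (X i) (Y i) (F i))"
proof
  assume y: "y \<in> cheb_centers S T PF"
  then have yT: "y \<in> T" and eq: "radius S y PF = cheb_rad S T PF"
    by (auto simp: cheb_centers_def)
  have yi: "y i \<in> Y i" for i using yT by (simp add: mem_T_iff)
  have "r i (y i) powr p - \<rho> i powr p = 0" for i
    using excess_sums[OF yT] suminf_eq_zero_iff[of "\<lambda>i. r i (y i) powr p - \<rho> i powr p"] \<rho>_powr_le yi eq
    by (simp add: sums_iff)
  then have "r i (y i) \<le> \<rho> i" for i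
    using p_pos \<rho>_nonneg[of i] radius_nonneg_Y[OF yi, of i]
    by (subst powr_le_powr_iff[where p = p, symmetric]) auto
  then show "\<forall>i. y i \<in> cheb_centers (X i) (Y i) (F i)"
    using \<rho>_le yi by (auto simp: cheb_centers_def intro: antisym)
next
  assume *: "\<forall>i. y i \<in> cheb_centers (X i) (Y i) (F i)"
  then have yi: "y i \<in> Y i" and eq: "r i (y i) = \<rho> i" for i by (auto simp: cheb_centers_def)
  have yT: "y \<in> T"
    using mem_T_if_powr_le[of y "\<lambda>_. 0"] yi eq by simp
  have "radius S y PF powr p = cheb_rad S T PF powr p"
    using excess_sums[OF yT] by (simp add: eq sums_iff)
  then have "radius S y PF \<le> cheb_rad S T PF"
    using p_pos cheb_rad_S_nonneg T_subset yT
    by (subst powr_le_powr_iff[where p = p, symmetric]) (auto intro!: radius_nonneg[OF CB_Pi])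
  then show "y \<in> cheb_centers S T PF"
    using yT cheb_rad_le_radius[OF CB_Pi T_subset yT] by (auto simp: cheb_centers_def)
qed

section \<open>Transfer of the property in both directions\<close>

text \<open>A center of the product is altered in coordinate \<open>i\<close> only, so the excess of
  the new point comes from that coordinate alone.\<close>

lemma P1_component:
  assumes P: "property_P1 S T PF"
  shows "property_P1 (X i) (Y i) (F i)"
proof -
  interpret X: real_normed_space "X j" for j by (rule rns)
  obtain z where z: "z \<in> cheb_centers S T PF"
    using P by (auto simp: property_P1_def)
  have zi: "z j \<in> Y j" "r j (z j) = \<rho> j" for j
    using z unfolding cheb_centers_iff by (auto simp: cheb_centers_def)
  have "cheb_centers (X i) (Y i) (F i) \<noteq> {}" using z cheb_centers_iff by auto
  moreover have "\<exists>\<delta>>0. \<forall>y\<in>near_centers (X i) (Y i) (F i) \<delta>.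
      \<exists>z\<in>cheb_centers (X i) (Y i) (F i). vnorm (X i) (y \<ominus>\<^bsub>X i\<^esub> z) \<le> \<epsilon>"
    if \<epsilon>: "\<epsilon> > 0" for \<epsilon>
  proof -
    obtain d where d: "d > 0"
      "\<And>y. y \<in> near_centers S T PF d \<Longrightarrow> \<exists>z\<in>cheb_centers S T PF. vnorm S (y \<ominus>\<^bsub>S\<^esub> z) \<le> \<epsilon>"
      using P \<epsilon> unfolding property_P1_iff[OF T_subset] by blast
    define R where "R = cheb_rad S T PF"
    have R0: "0 \<le> R" unfolding R_def by (rule cheb_rad_S_nonneg)
    have "R powr p < (R + d) powr p"
      using R0 d p_pos by (intro powr_less_mono2) auto
    \<comment> \<open>The excess permitted in coordinate \<open>i\<close> is exactly what a point of
      radius at most \<open>R + d\<close> may have in total.\<close>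
    then obtain \<delta> where \<delta>: "0 < \<delta>" "(\<rho> i + \<delta>) powr p \<le> \<rho> i powr p + ((R + d) powr p - R powr p)"
      using powr_add_le_ex[OF \<rho>_nonneg p_pos, of "(R + d) powr p - R powr p" i] by auto
    show ?thesis
    proof (intro exI[of _ \<delta>] conjI \<delta> ballI)
      fix v assume "v \<in> near_centers (X i) (Y i) (F i) \<delta>"
      then have v: "v \<in> Y i" "r i v \<le> \<rho> i + \<delta>" by (auto simp: near_centers_def)
      define e where "e = (R + d) powr p - R powr p"
      define y where "y = z(i := v)"
      have "r i v powr p \<le> (\<rho> i + \<delta>) powr p"
        using v(2) p_pos radius_nonneg_Y[OF v(1)] by (intro powr_mono2) auto
      then have yle: "r j (y j) powr p \<le> \<rho> j powr p + (if j = i then e else 0)" for j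
        using \<delta> zi by (auto simp: y_def e_def)
      have es: "(\<lambda>j. if j = i then e else 0) sums e" by (rule sums_single)
      have yT: "y \<in> T"
        using yle zi v sums_summable[OF es]
        by (intro mem_T_if_powr_le[where e = "\<lambda>j. if j = i then e else 0"]) (auto simp: y_def)
      then have yS: "y \<in> carrier S" using T_subset by auto
      have "radius S y PF powr p \<le> R powr p + e"
        unfolding R_def
        by (rule sums_le[OF yle radius_powr_sums[OF yS] sums_add[OF cheb_rad_powr_sums es]])
      then have "radius S y PF \<le> R + d"
        using R0 d p_pos radius_nonneg[OF CB_Pi yS]
        by (subst powr_le_powr_iff[where p = p, symmetric]) (auto simp: e_def)
      then have "y \<in> near_centers S T PF d"
        using yT by (simp add: near_centers_def R_def)
      then obtain w where w: "w \<in> cheb_centers S T PF" "vnorm S (y \<ominus>\<^bsub>S\<^esub> w) \<le> \<epsilon>"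
        using d by blast
      have wS: "w \<in> carrier S" using w T_subset by (auto simp: cheb_centers_def)
      \<comment> \<open>The coordinate \<open>w i\<close> is the center sought, as passing to a
        coordinate does not increase the norm.\<close>
      have "vnorm (X i) (v \<ominus>\<^bsub>X i\<^esub> w i) \<le> \<epsilon>"
        using vnorm_component_le[of "y \<ominus>\<^bsub>S\<^esub> w" i] w yS wS
        by (simp add: minus_lp) (simp add: y_def)
      then show "\<exists>z\<in>cheb_centers (X i) (Y i) (F i). vnorm (X i) (v \<ominus>\<^bsub>X i\<^esub> z) \<le> \<epsilon>"
        using w cheb_centers_iff by blast
    qed
  qed
  ultimately show ?thesis
    unfolding X.property_P1_iff[OF Y_subset] by blast
qed

text \<open>The budget \<open>\<epsilon> powr p\<close> is split in half between the first
  \<open>N\<close> coordinates and the tail.\<close>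

lemma P1_lp_sum:
  assumes P: "\<And>i. property_P1 (X i) (Y i) (F i)"
  shows "property_P1 S T PF"
proof -
  interpret X: real_normed_space "X i" for i by (rule rns)
  have "\<exists>z. z \<in> cheb_centers (X i) (Y i) (F i)" for i
    using P[of i] by (auto simp: property_P1_def)
  then obtain c where c: "\<And>i. c i \<in> cheb_centers (X i) (Y i) (F i)" by metis
  show ?thesis
    unfolding property_P1_iff[OF T_subset]
  proof (intro conjI allI impI)
    show "cheb_centers S T PF \<noteq> {}" using c cheb_centers_iff by auto
    fix \<epsilon> :: real assume \<epsilon>: "\<epsilon> > 0"
    \<comment> \<open>Chosen so that \<open>2 powr p * (h + h)\<close> is half of
      \<open>\<epsilon> powr p\<close>: one \<open>h\<close> for the tail of the \<rho> series, one
      for the total excess.\<close>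
    define h where "h = \<epsilon> powr p / 2 / 2 powr p / 2"
    have h: "h > 0" using \<epsilon> by (simp add: h_def)
    obtain N where N: "(\<Sum>i. \<rho> (i + N) powr p) < h"
      using suminf_exist_split[OF h summable_\<rho>] by (auto simp: abs_less_iff)
    \<comment> \<open>Equal shares for the first \<open>N\<close> coordinates; \<open>Suc N\<close>
      avoids division by zero when \<open>N = 0\<close>.\<close>
    define \<epsilon>' where "\<epsilon>' = (\<epsilon> powr p / 2 / real (Suc N)) powr (1 / p)"
    have \<epsilon>': "\<epsilon>' > 0" "\<epsilon>' powr p = \<epsilon> powr p / 2 / real (Suc N)"
      using \<epsilon> p_pos by (auto simp: \<epsilon>'_def powr_powr)
    have "\<forall>i. \<exists>d>0. \<forall>y\<in>near_centers (X i) (Y i) (F i) d.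
        \<exists>z\<in>cheb_centers (X i) (Y i) (F i). vnorm (X i) (y \<ominus>\<^bsub>X i\<^esub> z) \<le> \<epsilon>'"
      using P \<epsilon>'(1) unfolding X.property_P1_iff[OF Y_subset] by blast
    then obtain D where D: "\<And>i. D i > 0" "\<And>i y. y \<in> near_centers (X i) (Y i) (F i) (D i) \<Longrightarrow>
        \<exists>z\<in>cheb_centers (X i) (Y i) (F i). vnorm (X i) (y \<ominus>\<^bsub>X i\<^esub> z) \<le> \<epsilon>'"
      unfolding choice_iff by blast
    \<comment> \<open>The finite minimum makes each of the first \<open>N\<close> coordinates a near
      center. Inserting \<open>h\<close> bounds the tail excess and keeps the set nonempty when
      \<open>N = 0\<close>.\<close>
    define \<eta> where "\<eta> = Min (insert h ((\<lambda>i. (\<rho> i + D i) powr p - \<rho> i powr p) ` {..<N}))"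
    have "(\<rho> i + D i) powr p - \<rho> i powr p > 0" for i
      using powr_less_mono2[OF p_pos \<rho>_nonneg[of i], of "\<rho> i + D i"] D(1)[of i] by simp
    then have \<eta>: "\<eta> > 0" "\<eta> \<le> h" "\<And>i. i < N \<Longrightarrow> \<eta> \<le> (\<rho> i + D i) powr p - \<rho> i powr p"
      using h by (auto simp: \<eta>_def)
    define R where "R = cheb_rad S T PF"
    obtain \<delta> where \<delta>: "0 < \<delta>" "(R + \<delta>) powr p \<le> R powr p + \<eta>"
      using powr_add_le_ex[OF cheb_rad_S_nonneg p_pos \<eta>(1)] unfolding R_def by blast
    show "\<exists>\<delta>>0. \<forall>y\<in>near_centers S T PF \<delta>. \<exists>z\<in>cheb_centers S T PF. vnorm S (y \<ominus>\<^bsub>S\<^esub> z) \<le> \<epsilon>"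
    proof (intro exI[of _ \<delta>] conjI \<delta> ballI)
      fix y assume "y \<in> near_centers S T PF \<delta>"
      then have yT: "y \<in> T" and yr: "radius S y PF \<le> R + \<delta>"
        by (auto simp: near_centers_def R_def)
      have yS: "y \<in> carrier S" using yT T_subset by auto
      have yi: "y i \<in> Y i" for i using yT by (simp add: mem_T_iff)
      have "radius S y PF powr p \<le> (R + \<delta>) powr p"
        using yr p_pos radius_nonneg[OF CB_Pi yS] by (intro powr_mono2) auto
      then have exc: "radius S y PF powr p - R powr p \<le> \<eta>" using \<delta> by linarith
      define E where "E = (\<lambda>i. r i (y i) powr p - \<rho> i powr p)"
      have E0: "0 \<le> E i" for i using \<rho>_powr_le[OF yi] by (simp add: E_def)
      have Es: "summable E" and Ele: "suminf E \<le> \<eta>"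
        using excess_sums[OF yT] exc unfolding E_def R_def by (auto simp: sums_iff)
      have near: "y i \<in> near_centers (X i) (Y i) (F i) (D i)" if "i < N" for i
      proof -
        have "E i \<le> \<eta>" using sum_le_suminf[OF Es, of "{i}"] E0 Ele by simp
        then have "r i (y i) powr p \<le> (\<rho> i + D i) powr p"
          using \<eta>(3)[OF that] by (simp add: E_def)
        then have "r i (y i) \<le> \<rho> i + D i"
          using p_pos radius_nonneg_Y[OF yi, of i] \<rho>_nonneg[of i] D(1)[of i]
          by (subst powr_le_powr_iff[where p = p, symmetric]) auto
        then show ?thesis using yi by (simp add: near_centers_def)
      qed
      \<comment> \<open>Close centers are required only below \<open>N\<close>; further out any
        center, such as \<open>c i\<close>, will do.\<close>
      have "\<exists>z. z \<in> cheb_centers (X i) (Y i) (F i) \<and> (i < N \<longrightarrow> vnorm (X i) (y i \<ominus>\<^bsub>X i\<^esub> z) \<le> \<epsilon>')" for i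
        using c D(2)[OF near] by blast
      then obtain z where z: "\<And>i. z i \<in> cheb_centers (X i) (Y i) (F i)"
        "\<And>i. i < N \<Longrightarrow> vnorm (X i) (y i \<ominus>\<^bsub>X i\<^esub> z i) \<le> \<epsilon>'" by metis
      have zZ: "z \<in> cheb_centers S T PF" using z cheb_centers_iff by auto
      then have zS: "z \<in> carrier S" using T_subset by (auto simp: cheb_centers_def)
      have d: "y \<ominus>\<^bsub>S\<^esub> z \<in> carrier S" using yS zS by simp
      define w where "w = (\<lambda>i. vnorm (X i) ((y \<ominus>\<^bsub>S\<^esub> z) i))"
      have w0: "0 \<le> w i" for i unfolding w_def by (intro X.vnorm_nonneg carrier_lpD[OF d])
      have ws: "summable (\<lambda>i. w i powr p)" unfolding w_def by (rule summable_lpD[OF d])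
      have head: "(\<Sum>i<N. w i powr p) \<le> \<epsilon> powr p / 2"
      proof -
        have "(\<Sum>i<N. w i powr p) \<le> (\<Sum>i<N. \<epsilon>' powr p)"
          using z(2) w0 p_pos by (intro sum_mono powr_mono2) (auto simp: w_def minus_lp[OF yS zS])
        also have "\<dots> \<le> \<epsilon> powr p / 2"
          using \<epsilon> unfolding \<epsilon>'(2) by (simp add: field_simps)
        finally show ?thesis .
      qed
      \<comment> \<open>The radius at the center \<open>z i\<close> is \<rho>, hence at most that at
        \<open>y i\<close>, and the p-th power of the latter is \<rho> to the power p plus
        \<open>E i\<close>.\<close>
      have tail_le: "w i powr p \<le> 2 powr p * (\<rho> i powr p + E i)" for i
      proof -
        have "w i \<le> r i (y i) + r i (z i)"
          unfolding w_def minus_lp[OF yS zS]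
          by (intro X.vnorm_minus_le_radius_add CB_component carrier_lpD yS zS)
        also have "\<dots> \<le> 2 * r i (y i)"
          using z(1)[of i] \<rho>_le[OF yi, of i] by (simp add: cheb_centers_def)
        finally have "w i powr p \<le> (2 * r i (y i)) powr p"
          using w0 p_pos by (intro powr_mono2) auto
        then show ?thesis
          using radius_component_nonneg[of "y i" i] carrier_lpD[OF yS] by (simp add: E_def powr_mult)
      qed
      have tail: "(\<Sum>i. w (i + N) powr p) \<le> \<epsilon> powr p / 2"
      proof -
        have s1: "summable (\<lambda>i. \<rho> (i + N) powr p)" and s2: "summable (\<lambda>i. E (i + N))"
          using summable_ignore_initial_segment[OF summable_\<rho>] summable_ignore_initial_segment[OF Es]
          by auto
        have "(\<Sum>i. w (i + N) powr p) \<le> (\<Sum>i. 2 powr p * (\<rho> (i + N) powr p + E (i + N)))"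
          by (intro suminf_le tail_le summable_mult summable_add s1 s2
              summable_ignore_initial_segment[OF ws])
        also have "\<dots> = 2 powr p * ((\<Sum>i. \<rho> (i + N) powr p) + (\<Sum>i. E (i + N)))"
          unfolding suminf_add[OF s1 s2] by (rule suminf_mult[OF summable_add[OF s1 s2]])
        also have "(\<Sum>i. E (i + N)) \<le> suminf E"
          using suminf_split_initial_segment[OF Es, of N] sum_nonneg[of "{..<N}" E] E0 by simp
        also have "2 powr p * ((\<Sum>i. \<rho> (i + N) powr p) + suminf E) \<le> 2 powr p * (h + h)"
          using N Ele \<eta>(2) by (intro mult_left_mono) auto
        also have "\<dots> = \<epsilon> powr p / 2" by (simp add: h_def)
        finally show ?thesis by simp
      qed
      have "(\<Sum>i. w i powr p) \<le> \<epsilon> powr p"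
        using suminf_split_initial_segment[OF ws, of N] head tail by simp
      then have "vnorm S (y \<ominus>\<^bsub>S\<^esub> z) powr p \<le> \<epsilon> powr p"
        unfolding vnorm_powr_lp[OF d] w_def .
      then have "vnorm S (y \<ominus>\<^bsub>S\<^esub> z) \<le> \<epsilon>"
        using p_pos \<epsilon> vnorm_nonneg[OF d] by (subst powr_le_powr_iff[where p = p, symmetric]) auto
      then show "\<exists>z\<in>cheb_centers S T PF. vnorm S (y \<ominus>\<^bsub>S\<^esub> z) \<le> \<epsilon>" using zZ by blast
    qed
  qed
qed

end

theorem theorem3p3:
  fixes X :: "nat \<Rightarrow> 'a normed_space" and Y F :: "nat \<Rightarrow> 'a set" and p :: real
  assumes "\<And>i. real_banach_space (X i)"
    and "\<And>i. closed_linear_subspace (Y i) (X i)"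
    and "1 \<le> p"
    and "\<And>i. F i \<in> CB (X i)"
    and "Pi UNIV F \<in> product_CB p X"
  shows "(\<forall>i. property_P1 (X i) (Y i) (F i)) \<longleftrightarrow>
         property_P1 (lp_sum p X) (lp_sum_sub p X Y) (Pi UNIV F)"
proof -
  have rns: "real_normed_space (X i)" for i
    using assms(1) by (simp add: real_banach_space_def)
  have sub: "submodule (Y i) real_ring (X i)" for i
    using assms(2) by (simp add: closed_linear_subspace_def)
  interpret lp_family_CB_sub X p F Y
  proof (intro lp_family_CB_sub.intro lp_family_CB.intro lp_family.intro
      lp_family_CB_axioms.intro lp_family_CB_sub_axioms.intro rns assms)
    show "Y i \<subseteq> carrier (X i)" for i
      using subgroup.subset[OF submodule.axioms(1)[OF sub]] by simp
    show "\<zero>\<^bsub>X i\<^esub> \<in> Y i" for i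
      \<comment> \<open>The subgroup lives in the additive monoid, whose unit is the zero
        vector.\<close>
      using subgroup.one_closed[OF submodule.axioms(1)[OF sub]] by simp
      show "Pi UNIV F \<in> CB (lp_sum p X)"
      using assms(5) by (simp add: product_CB_def)
  qed
  show ?thesis using P1_component P1_lp_sum by blast
qed

end
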